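(* Let $f,g\in C^2[0,1]$ and let $X=X(x)=x(1-x)$, $x\in[0,1]$. Then, as $n\to\infty$, $$\left\|n\left[K_n(fg)-K_nf\cdot K_ng\right]-Xf'g'\right\|_\infty=\begin{cases}o(1), & \text{if } f,g\in C^2[0,1],\\[2pt] \mathcal O\!\left(\dfrac{1}{\sqrt n}\right), & \text{if } f,g\in C^3[0,1],\\[6pt] \mathcal O\!\left(\dfrac1n\right), & \text{if } f,g\in C^4[0,1].\end{cases}$$
   Context: For $n\ge 1$, the classical Kantorovich operator is $$K_n(f;x)=(n+1)\sum_{k=0}^n p_{n,k}(x)\int_{k/(n+1)}^{(k+1)/(n+1)}f(t)\,dt,\qquad p_{n,k}(x)=\binom nk x^k(1-x)^{n-k},\quad x\in[0,1],$$ and $K_nf$ denotes the function $x\mapsto K_n(f;x)$. Functions are real-valued, and $\|\cdot\|_\infty$ is the supremum norm on $[0,1]$. The functions $f,g$ are fixed as $n\to\infty$; the constants implied in $\mathcal O$ may depend on $f$ and $g$ but not on $n$. *)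

theory Defs
  imports "HOL-Analysis.Analysis" "HOL-Library.Landau_Symbols"
begin

(* Bernstein n k x is the library's (n choose k) * x^k * (1 - x)^(n - k). *)
definition kantorovich :: "nat \<Rightarrow> (real \<Rightarrow> real) \<Rightarrow> real \<Rightarrow> real" where
  "kantorovich n f x = (real n + 1) *
     (\<Sum>k\<le>n. Bernstein n k x *
        integral {real k / (real n + 1) .. (real k + 1) / (real n + 1)} f)"

(* One-sided at the endpoints: for x in [0,1] the value depends only on f restricted to [0,1].
   Only values at points of [0,1] are meaningful. *)
definition deriv01 :: "(real \<Rightarrow> real) \<Rightarrow> real \<Rightarrow> real" where
  "deriv01 f x = vector_derivative f (at x within {0..1})"

definition C01 :: "nat \<Rightarrow> (real \<Rightarrow> real) set" where
  "C01 m = {f. (\<forall>i<m. (deriv01 ^^ i) f differentiable_on {0..1}) \<and>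
               continuous_on {0..1} ((deriv01 ^^ m) f)}"

(* A real-valued supremum: meaningful for functions bounded on [0,1], in particular for those
   continuous there. *)
definition supnorm01 :: "(real \<Rightarrow> real) \<Rightarrow> real" where
  "supnorm01 h = (SUP x\<in>{0..1}. \<bar>h x\<bar>)"

end

theory Submission
  imports Defs
begin

text \<open>
  For fixed \<open>x\<close> and \<open>n\<close>, the map \<open>a \<mapsto> K\<^sub>n(a;x)\<close> is an expectation: it is linear, positive and
  maps constants to themselves. So \<open>K\<^sub>n(fg) - K\<^sub>nf K\<^sub>ng\<close> is a covariance, which is unchanged when
  constants are added to \<open>f\<close> or \<open>g\<close>. Write \<open>u(t) = t - x\<close> and \<open>f = f(x) + f'(x) u + F\<close>,
  \<open>g = g(x) + g'(x) u + G\<close>, where \<open>F\<close> and \<open>G\<close> are \<open>O(u\<^sup>2)\<close> uniformly in \<open>x\<close>. Bilinearity gives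
  (\<open>kantorovich_cov_expansion\<close>)
  \<open>cov(f, g) = f'g' var(u) + f' cov(u, G) + g' cov(u, F) + cov(F, G)\<close>.

  Let \<open>\<sigma> = 1 / sqrt (n + 1)\<close>. The fourth moment of \<open>u\<close> is at most \<open>\<sigma>^4\<close>, hence \<open>|u|^j\<close> has expectation
  \<open>O(\<sigma>^j)\<close> for all \<open>j \<le> 4\<close>, and the covariance of an \<open>O(|u|^i)\<close> with an \<open>O(|u|^j)\<close> is \<open>O(\<sigma>^(i+j))\<close>
  whenever \<open>i + j \<le> 4\<close> (\<open>kantorovich_cov_le\<close>). The exact second moments give
  \<open>n var(u) - x(1 - x) = O(1/n)\<close>, and \<open>n cov(F, G) = O(1/n)\<close>. The rate is therefore decided by
  \<open>cov(u, F)\<close> and \<open>cov(u, G)\<close>: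

  \<^item> For \<open>f\<close> in \<open>C\<^sup>2\<close> only \<open>F = O(u\<^sup>2)\<close> is available and \<open>cov(u, F) = O(\<sigma>^3)\<close>. After multiplication by
    \<open>n\<close> this is \<open>O(1 / sqrt n)\<close>, which implies both \<open>o(1)\<close> and the rate claimed for \<open>C\<^sup>3\<close>.

  \<^item> For \<open>f\<close> in \<open>C\<^sup>3\<close> one has \<open>F = f''(x)/2 u\<^sup>2 + O(|u|^3)\<close>. The third moment of \<open>u\<close> is \<open>O(\<sigma>^4)\<close>, one
    order smaller than the bound for the absolute moment, because the third central moment of the
    binomial distribution is linear in \<open>n\<close>, like the second. So \<open>cov(u, u\<^sup>2) = O(\<sigma>^4)\<close>, hence
    \<open>cov(u, F) = O(\<sigma>^4)\<close>, and the error is \<open>O(1/n)\<close>. The claim for \<open>C\<^sup>4\<close> follows, as \<open>C\<^sup>4\<close> is contained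
    in \<open>C\<^sup>3\<close>.

  The moments of \<open>u\<close> come from the central moments of the binomial distribution
  (\<open>bernstein_moments\<close>), since \<open>u\<close> is \<open>1/(n+1)\<close> times a centred binomial variable plus an independent
  variable that is uniform on \<open>[-x, 1-x]\<close>.
\<close>

section \<open>Central moments of the binomial distribution\<close>

text \<open>
  Pascal's rule in the form of conditioning on the last of \<open>n + 1\<close> independent trials. It turns
  every statement about Bernstein sums into a recursion in \<open>n\<close>.
\<close>
lemma sum_Bernstein_Suc:
  "(\<Sum>k\<le>Suc n. Bernstein (Suc n) k x * \<phi> k) =
   (\<Sum>k\<le>n. Bernstein n k x * ((1 - x) * \<phi> k + x * \<phi> (Suc k)))"
proof -
  have step: "Bernstein (Suc n) (Suc k) x = x * Bernstein n k x + (1 - x) * Bernstein n (Suc k) x"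
    if "k \<le> n" for k
  proof (cases "k = n")
    case False
    with that have "n - k = Suc (n - Suc k)" by simp
    then show ?thesis
      by (simp add: Bernstein_def algebra_simps)
  qed (simp add: Bernstein_def algebra_simps)
  have "(\<Sum>k\<le>Suc n. Bernstein (Suc n) k x * \<phi> k) =
      Bernstein (Suc n) 0 x * \<phi> 0 + (\<Sum>k\<le>n. Bernstein (Suc n) (Suc k) x * \<phi> (Suc k))"
    by (simp only: sum.atMost_Suc_shift)
  also have "\<dots> = (1 - x) * (Bernstein n 0 x * \<phi> 0 + (\<Sum>k\<le>n. Bernstein n (Suc k) x * \<phi> (Suc k)))
      + (\<Sum>k\<le>n. x * (Bernstein n k x * \<phi> (Suc k)))"
  proof -
    have "(\<Sum>k\<le>n. Bernstein (Suc n) (Suc k) x * \<phi> (Suc k)) =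
        (\<Sum>k\<le>n. (1 - x) * (Bernstein n (Suc k) x * \<phi> (Suc k)) + x * (Bernstein n k x * \<phi> (Suc k)))"
      by (rule sum.cong) (simp_all add: step algebra_simps)
    moreover have "Bernstein (Suc n) 0 x = (1 - x) * Bernstein n 0 x"
      by (simp add: Bernstein_def)
    ultimately show ?thesis
      by (simp add: sum.distrib sum_distrib_left distrib_left mult.assoc)
  qed
  also have "Bernstein n 0 x * \<phi> 0 + (\<Sum>k\<le>n. Bernstein n (Suc k) x * \<phi> (Suc k))
      = (\<Sum>k\<le>Suc n. Bernstein n k x * \<phi> k)"
    by (simp only: sum.atMost_Suc_shift)
  also have "\<dots> = (\<Sum>k\<le>n. Bernstein n k x * \<phi> k)"
    by (simp add: Bernstein_def)
  finally show ?thesis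
    by (simp add: sum.distrib sum_distrib_left distrib_left mult.left_commute)
qed

definition bernstein_moment :: "nat \<Rightarrow> real \<Rightarrow> nat \<Rightarrow> real" where
  "bernstein_moment n x j = (\<Sum>k\<le>n. Bernstein n k x * (real k - real n * x) ^ j)"

lemma sum_Bernstein_quartic:
  fixes p q r s w :: real
  defines "d \<equiv> \<lambda>n x k. real k - real n * x"
  shows "(\<Sum>k\<le>n. Bernstein n k x * (p + q * d n x k + r * d n x k ^ 2 + s * d n x k ^ 3 + w * d n x k ^ 4)) =
     p * bernstein_moment n x 0 + q * bernstein_moment n x 1 + r * bernstein_moment n x 2
     + s * bernstein_moment n x 3 + w * bernstein_moment n x 4"
  unfolding bernstein_moment_def d_def sum_distrib_left sum.distrib[symmetric]
  by (rule sum.cong) (simp_all add: distrib_left mult.left_commute)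

lemma bernstein_moment_Suc:
  "bernstein_moment (Suc n) x j =
   (\<Sum>k\<le>n. Bernstein n k x * ((1 - x) * (real k - real n * x - x) ^ j
                               + x * (real k - real n * x + (1 - x)) ^ j))"
  unfolding bernstein_moment_def sum_Bernstein_Suc by (simp add: algebra_simps)

text \<open>
  The first five moments are proved together, because the recursion for the \<open>j\<close>-th one involves all
  lower ones. In the induction step a power of the deviation, averaged over one more trial, is
  written as a polynomial in the old deviation.
\<close>
lemma bernstein_moments:
  "bernstein_moment n x 0 = 1"
  "bernstein_moment n x 1 = 0"
  "bernstein_moment n x 2 = real n * (x * (1 - x))"
  "bernstein_moment n x 3 = real n * (x * (1 - x)) * (1 - 2 * x)"
  "bernstein_moment n x 4 = 3 * (real n)\<^sup>2 * (x * (1 - x))\<^sup>2 + real n * (x * (1 - x)) * (1 - 6 * (x * (1 - x)))"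
proof (induction n)
  case 0
  {
    case 1 show ?case by (simp add: bernstein_moment_def Bernstein_def)
  next
    case 2 show ?case by (simp add: bernstein_moment_def Bernstein_def)
  next
    case 3 show ?case by (simp add: bernstein_moment_def Bernstein_def)
  next
    case 4 show ?case by (simp add: bernstein_moment_def Bernstein_def)
  next
    case 5 show ?case by (simp add: bernstein_moment_def Bernstein_def)
  }
next
  case (Suc n)
  let ?m = "bernstein_moment n x"
  have expand: "bernstein_moment (Suc n) x j = p * ?m 0 + q * ?m 1 + r * ?m 2 + s * ?m 3 + w * ?m 4"
    if "\<And>d. (1 - x) * (d - x) ^ j + x * (d + (1 - x)) ^ j = p + q * d + r * d^2 + s * d^3 + w * d^4"
    for j p q r s w
    unfolding bernstein_moment_Suc that by (rule sum_Bernstein_quartic)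
  {
    case 1
    show ?case using expand[of 0 1 0 0 0 0] Suc by simp
  next
    case 2
    show ?case using expand[of 1 0 1 0 0 0] Suc by (simp add: algebra_simps)
  next
    case 3
    show ?case using expand[of 2 "x * (1 - x)" 0 1 0 0] Suc by (simp add: algebra_simps power2_eq_square)
  next
    case 4
    have "bernstein_moment (Suc n) x 3 = x * (1 - x) * (1 - 2 * x) * ?m 0 + 3 * (x * (1 - x)) * ?m 1
        + 0 * ?m 2 + 1 * ?m 3 + 0 * ?m 4"
      by (rule expand) algebra
    then show ?case using Suc by (simp add: algebra_simps)
  next
    case 5
    have "bernstein_moment (Suc n) x 4 = x * (1 - x) * (1 - 3 * (x * (1 - x))) * ?m 0
        + 4 * (x * (1 - x) * (1 - 2 * x)) * ?m 1 + 6 * (x * (1 - x)) * ?m 2 + 0 * ?m 3 + 1 * ?m 4"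
      by (rule expand) algebra
    then have "bernstein_moment (Suc n) x 4 = x * (1 - x) * (1 - 3 * (x * (1 - x)))
        + 6 * (x * (1 - x)) * (real n * (x * (1 - x)))
        + (3 * (real n)\<^sup>2 * (x * (1 - x))\<^sup>2 + real n * (x * (1 - x)) * (1 - 6 * (x * (1 - x))))"
      unfolding Suc by simp
    moreover have "X * (1 - 3 * X) + 6 * X * (m * X) + (3 * m\<^sup>2 * X\<^sup>2 + m * X * (1 - 6 * X))
        = 3 * (1 + m)\<^sup>2 * X\<^sup>2 + (1 + m) * X * (1 - 6 * X)" for X m :: real
      by (simp add: algebra_simps power2_eq_square)
    ultimately show ?case by simp
  }
qed

section \<open>The Kantorovich operator as an expectation\<close>
lemma kantorovich_subinterval:
  assumes "k \<le> n"
  shows "{real k / (real n + 1) .. (real k + 1) / (real n + 1)} \<subseteq> {0..1}"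
proof -
  have "real k + 1 \<le> real n + 1" using assms by simp
  then have "(real k + 1) / (real n + 1) \<le> 1"
    by (simp add: divide_le_eq_1)
  then show ?thesis by (intro atLeastatMost_subset_iff[THEN iffD2]) simp
qed

lemma kantorovich_integrable:
  fixes a :: "real \<Rightarrow> real"
  assumes "continuous_on {0..1} a" "k \<le> n"
  shows "a integrable_on {real k / (real n + 1) .. (real k + 1) / (real n + 1)}"
  by (rule integrable_continuous_interval)
     (rule continuous_on_subset[OF assms(1) kantorovich_subinterval[OF assms(2)]])

lemma kantorovich_add:
  assumes "continuous_on {0..1} a" "continuous_on {0..1} b"
  shows "kantorovich n (\<lambda>t. a t + b t) x = kantorovich n a x + kantorovich n b x"
  unfolding kantorovich_def
  by (simp add: integral_add kantorovich_integrable assms sum.distrib distrib_left)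

lemma kantorovich_cmult: "kantorovich n (\<lambda>t. c * a t) x = c * kantorovich n a x"
  unfolding kantorovich_def by (simp add: sum_distrib_left mult_ac)

lemma kantorovich_abs_le:
  assumes "x \<in> {0..1}" "continuous_on {0..1} a" "continuous_on {0..1} b"
    and "\<And>t. t \<in> {0..1} \<Longrightarrow> \<bar>a t\<bar> \<le> b t"
  shows "\<bar>kantorovich n a x\<bar> \<le> kantorovich n b x"
proof -
  have "\<bar>integral {real k / (real n + 1) .. (real k + 1) / (real n + 1)} a\<bar>
      \<le> integral {real k / (real n + 1) .. (real k + 1) / (real n + 1)} b" if "k \<le> n" for k
    unfolding real_norm_def[symmetric]
    using assms(4) kantorovich_subinterval[OF that, THEN subsetD]
    by (intro integral_norm_bound_integral kantorovich_integrable assms(2,3) that) simp_all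
  moreover have "0 \<le> Bernstein n k x" for k
    using assms(1) by (simp add: Bernstein_nonneg)
  ultimately have "\<bar>\<Sum>k\<le>n. Bernstein n k x * integral {real k / (real n + 1) .. (real k + 1) / (real n + 1)} a\<bar>
      \<le> (\<Sum>k\<le>n. Bernstein n k x * integral {real k / (real n + 1) .. (real k + 1) / (real n + 1)} b)"
    by (intro order_trans[OF sum_abs] sum_mono) (auto simp: abs_mult intro!: mult_left_mono)
  then show ?thesis
    unfolding kantorovich_def by (simp add: abs_mult mult_left_mono)
qed

lemma integral_centred_power:
  fixes a b x :: real
  assumes "a \<le> b"
  shows "integral {a..b} (\<lambda>t. (t - x) ^ j) = ((b - x) ^ Suc j - (a - x) ^ Suc j) / real (Suc j)"
proof (rule integral_unique)
  have "((\<lambda>t. (t - x) ^ j) has_integral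
      ((b - x) ^ Suc j / real (Suc j) - (a - x) ^ Suc j / real (Suc j))) {a..b}"
    by (rule fundamental_theorem_of_calculus[OF assms])
       (auto intro!: derivative_eq_intros simp flip: has_real_derivative_iff_has_vector_derivative simp del: of_nat_Suc power_Suc)
  then show "((\<lambda>t. (t - x) ^ j) has_integral
      ((b - x) ^ Suc j - (a - x) ^ Suc j) / real (Suc j)) {a..b}"
    by (simp add: diff_divide_distrib)
qed

text \<open>
  The antiderivative of \<open>(t - x)^j\<close> at the nodes \<open>k/(n+1)\<close> depends on \<open>k\<close> only through the
  deviation \<open>d = k - nx\<close>, because \<open>k - (n+1)x = d - x\<close>. The leading powers in the difference cancel, so
  that the summand is a polynomial of degree \<open>j\<close> in \<open>d\<close>.
\<close>
lemma kantorovich_centred_power: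
  "kantorovich n (\<lambda>t. (t - x) ^ j) x * (real n + 1) ^ j =
     (\<Sum>k\<le>n. Bernstein n k x * (((real k - real n * x + (1 - x)) ^ Suc j
                               - (real k - real n * x - x) ^ Suc j) / real (Suc j)))"
proof -
  let ?N = "real n + 1"
  have "integral {real k / ?N .. (real k + 1) / ?N} (\<lambda>t. (t - x) ^ j) * ?N * ?N ^ j =
      ((real k - real n * x + (1 - x)) ^ Suc j - (real k - real n * x - x) ^ Suc j) / real (Suc j)" for k
  proof -
    have "(real k + 1) / ?N - x = (real k - real n * x + (1 - x)) / ?N"
         "real k / ?N - x = (real k - real n * x - x) / ?N"
      by (simp_all add: field_simps)
    then have "integral {real k / ?N .. (real k + 1) / ?N} (\<lambda>t. (t - x) ^ j) =
        (((real k - real n * x + (1 - x)) / ?N) ^ Suc j - ((real k - real n * x - x) / ?N) ^ Suc j) / real (Suc j)"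
      by (subst integral_centred_power) (simp_all add: divide_right_mono del: power_Suc)
    also have "\<dots> = (((real k - real n * x + (1 - x)) ^ Suc j - (real k - real n * x - x) ^ Suc j) / real (Suc j)) / ?N ^ Suc j"
      by (simp only: power_divide) (simp add: diff_divide_distrib mult.commute del: power_Suc of_nat_Suc)
    finally show ?thesis by simp
  qed
  note scaled = this
  show ?thesis
    unfolding kantorovich_def sum_distrib_left sum_distrib_right scaled[symmetric]
    by (intro sum.cong refl) (simp add: mult_ac)
qed

lemma kantorovich_moment_from_bernstein:
  assumes "\<And>d. (d + (1 - x)) ^ Suc j - (d - x) ^ Suc j
             = real (Suc j) * (p + q * d + r * d^2 + s * d^3 + w * d^4)"
  shows "kantorovich n (\<lambda>t. (t - x) ^ j) x * (real n + 1) ^ j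
    = p + r * bernstein_moment n x 2 + s * bernstein_moment n x 3 + w * bernstein_moment n x 4"
proof -
  have "kantorovich n (\<lambda>t. (t - x) ^ j) x * (real n + 1) ^ j
    = p * bernstein_moment n x 0 + q * bernstein_moment n x 1 
      + r * bernstein_moment n x 2 + s * bernstein_moment n x 3 + w * bernstein_moment n x 4"
    unfolding kantorovich_centred_power assms
    by (simp only: sum_Bernstein_quartic nonzero_mult_div_cancel_left of_nat_eq_0_iff Suc_neq_Zero not_False_eq_True)
  then show ?thesis by (simp only: bernstein_moments(1,2) mult_zero_right mult_1_right add_0_right)
qed

lemma kantorovich_const: "kantorovich n (\<lambda>t. c) x = c"
proof -
  have "kantorovich n (\<lambda>t. 1) x = 1"
    using kantorovich_moment_from_bernstein[of x 0 1 0 0 0 0 n] by simp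
  then show ?thesis
    using kantorovich_cmult[of n c "\<lambda>t. 1" x] by simp
qed

lemma kantorovich_moments:
  defines "X \<equiv> \<lambda>x. x * (1 - x) :: real"
  shows "kantorovich n (\<lambda>t. t - x) x * (real n + 1) = 1/2 - x"
    and "kantorovich n (\<lambda>t. (t - x)^2) x * (real n + 1)^2 = real n * X x + 1/3 - X x"
    and "kantorovich n (\<lambda>t. (t - x)^3) x * (real n + 1)^3 =
           (5/2 * (real n * X x) + (1/4 - X x / 2)) * (1 - 2 * x)"
    and "kantorovich n (\<lambda>t. (t - x)^4) x * (real n + 1)^4 =
           3 * (real n)^2 * (X x)^2 + real n * X x * (5 - 20 * X x) + (1/5 - X x + (X x)^2)"
proof -
  have "kantorovich n (\<lambda>t. (t - x)^1) x * (real n + 1)^1 =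
      (1/2 - x) + 0 * bernstein_moment n x 2 + 0 * bernstein_moment n x 3 + 0 * bernstein_moment n x 4"
    by (rule kantorovich_moment_from_bernstein[where q = 1])
       (simp add: field_simps power2_eq_square)
  then show "kantorovich n (\<lambda>t. t - x) x * (real n + 1) = 1/2 - x"
    by simp
  have "kantorovich n (\<lambda>t. (t - x)^2) x * (real n + 1)^2 =
      (1/3 - X x) + 1 * bernstein_moment n x 2 + 0 * bernstein_moment n x 3 + 0 * bernstein_moment n x 4"
    unfolding X_def
    by (rule kantorovich_moment_from_bernstein[where q = "1 - 2 * x"])
       (simp only: Suc_numeral semiring_norm of_nat_numeral, algebra)
  then show "kantorovich n (\<lambda>t. (t - x)^2) x * (real n + 1)^2 = real n * X x + 1/3 - X x"
    by (simp add: bernstein_moments X_def)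
  have "kantorovich n (\<lambda>t. (t - x)^3) x * (real n + 1)^3 =
      ((1 - x)^4 - x^4)/4 + (3/2 * (1 - 2 * x)) * bernstein_moment n x 2 + 1 * bernstein_moment n x 3 + 0 * bernstein_moment n x 4"
    by (rule kantorovich_moment_from_bernstein[where q = "(1-x)^3 + x^3"])
       (simp only: Suc_numeral semiring_norm of_nat_numeral, algebra)
  note third = this
  show "kantorovich n (\<lambda>t. (t - x)^3) x * (real n + 1)^3 =
           (5/2 * (real n * X x) + (1/4 - X x / 2)) * (1 - 2 * x)"
  proof -
    have "((1 - x)^4 - x^4)/4 + (3/2 * (1 - 2 * x)) * (m * X) + 1 * (m * X * (1 - 2 * x)) + 0 * l
        = (5/2 * (m * X) + (1/4 - X / 2)) * (1 - 2 * x)"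
      if "X = x * (1 - x)" for X m l :: real
      unfolding that by (simp add: field_simps eval_nat_numeral)
    then show ?thesis using third by (simp only: bernstein_moments X_def)
  qed
  have "kantorovich n (\<lambda>t. (t - x)^4) x * (real n + 1)^4 =
      ((1 - x)^5 + x^5)/5 + (2 * ((1-x)^3 + x^3)) * bernstein_moment n x 2 + (2 * (1 - 2 * x)) * bernstein_moment n x 3 + 1 * bernstein_moment n x 4"
    by (rule kantorovich_moment_from_bernstein[where q = "(1-x)^4 - x^4"])
       (simp only: Suc_numeral semiring_norm of_nat_numeral, algebra)
  note fourth = this
  show "kantorovich n (\<lambda>t. (t - x)^4) x * (real n + 1)^4 =
           3 * (real n)^2 * (X x)^2 + real n * X x * (5 - 20 * X x) + (1/5 - X x + (X x)^2)"
  proof -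
    have "((1 - x)^5 + x^5)/5 + (2 * ((1-x)^3 + x^3)) * (m * X) + (2 * (1 - 2 * x)) * (m * X * (1 - 2 * x))
          + 1 * (3 * m\<^sup>2 * X\<^sup>2 + m * X * (1 - 6 * X))
        = 3 * m^2 * X^2 + m * X * (5 - 20 * X) + (1/5 - X + X^2)"
      if "X = x * (1 - x)" for X m :: real
      unfolding that by (simp add: field_simps eval_nat_numeral)
    then show ?thesis using fourth by (simp only: bernstein_moments X_def)
  qed
qed

section \<open>Covariance and its order of magnitude\<close>
definition kantorovich_cov :: "nat \<Rightarrow> real \<Rightarrow> (real \<Rightarrow> real) \<Rightarrow> (real \<Rightarrow> real) \<Rightarrow> real" where
  "kantorovich_cov n x a b =
     kantorovich n (\<lambda>t. a t * b t) x - kantorovich n a x * kantorovich n b x"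

lemma kantorovich_cov_commute: "kantorovich_cov n x a b = kantorovich_cov n x b a"
  by (simp add: kantorovich_cov_def mult.commute)

lemma kantorovich_cov_affine_left:
  assumes [continuous_intros]: "continuous_on {0..1} a" "continuous_on {0..1} a'" "continuous_on {0..1} b"
  shows "kantorovich_cov n x (\<lambda>t. c + p * a t + a' t) b =
         p * kantorovich_cov n x a b + kantorovich_cov n x a' b"
proof -
  have "kantorovich n (\<lambda>t. c + p * a t + a' t) x = c + p * kantorovich n a x + kantorovich n a' x"
    by (simp add: kantorovich_add kantorovich_cmult kantorovich_const continuous_intros)
  moreover have "kantorovich n (\<lambda>t. c * b t + p * (a t * b t) + a' t * b t) x =
      c * kantorovich n b x + p * kantorovich n (\<lambda>t. a t * b t) x + kantorovich n (\<lambda>t. a' t * b t) x"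
    by (simp add: kantorovich_add kantorovich_cmult continuous_intros)
  then have "kantorovich n (\<lambda>t. (c + p * a t + a' t) * b t) x =
      c * kantorovich n b x + p * kantorovich n (\<lambda>t. a t * b t) x + kantorovich n (\<lambda>t. a' t * b t) x"
    by (simp add: distrib_right mult.assoc)
  ultimately show ?thesis
    by (simp add: kantorovich_cov_def algebra_simps)
qed

text \<open>
  An upper bound for the standard deviation of the variable \<open>t\<close> under the expectation \<open>K\<^sub>n(.;x)\<close>,
  uniform in \<open>x\<close> and of the exact order in \<open>n\<close> at interior points. All error terms are measured in powers of this quantity.
\<close>
definition std_scale :: "nat \<Rightarrow> real" where
  "std_scale n = 1 / sqrt (real n + 1)"

lemma std_scale_pos: "0 < std_scale n"
  by (simp add: std_scale_def add_nonneg_pos)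

lemma std_scale_le_1: "std_scale n \<le> 1"
  by (simp add: std_scale_def)

lemma std_scale_square: "(std_scale n)\<^sup>2 = 1 / (real n + 1)"
  by (simp add: std_scale_def power_divide)

lemma std_scale_power4: "std_scale n ^ 4 = 1 / (real n + 1)\<^sup>2"
proof -
  have "std_scale n ^ 4 = ((std_scale n)\<^sup>2)\<^sup>2" by simp
  then show ?thesis unfolding std_scale_square by (simp add: power_divide)
qed

lemma unit_interval_variance_bounds:
  fixes x :: real
  assumes "x \<in> {0..1}"
  shows "0 \<le> x * (1 - x)" "x * (1 - x) \<le> 1/4"
proof -
  show "0 \<le> x * (1 - x)" using assms by simp
  show "x * (1 - x) \<le> 1/4"
    using zero_le_power2[of "x - 1/2"] by (simp add: power2_eq_square algebra_simps)
qed

lemma kantorovich_fourth_moment_le: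
  assumes "x \<in> {0..1}"
  shows "kantorovich n (\<lambda>t. (t - x)^4) x \<le> std_scale n ^ 4"
proof -
  define X where "X = x * (1 - x)"
  have X: "0 \<le> X" "X \<le> 1/4"
    using unit_interval_variance_bounds[OF assms] by (simp_all add: X_def)
  have XX: "X^2 \<le> 1/16" 
    using power_mono[OF X(2,1), of 2] by (simp add: power2_eq_square)
  have "3 * (real n)^2 * X^2 \<le> 3 * (real n)^2 * (1/16)"
    using XX by (intro mult_left_mono) simp_all
  moreover have "real n * X * (5 - 20 * X) \<le> real n * (1/4) * 5"
    using X by (intro mult_mono) simp_all
  moreover have "1/5 - X + X^2 \<le> 1" using X XX by linarith
  ultimately have "kantorovich n (\<lambda>t. (t - x)^4) x * (real n + 1)^4 \<le> (real n + 1)^2"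
    unfolding kantorovich_moments X_def[symmetric] power2_sum one_power2
    using zero_le_power2[of "real n"] of_nat_0_le_iff[of n, where ?'a = real] by linarith
  then have "kantorovich n (\<lambda>t. (t - x)^4) x \<le> (real n + 1)^2 / (real n + 1)^4"
    by (simp add: pos_le_divide_eq)
  also have "\<dots> = std_scale n ^ 4"
    unfolding std_scale_power4 by (simp add: power4_eq_xxxx power2_eq_square)
  finally show ?thesis .
qed

text \<open>
  Interpolation between the moments of order 0 and 4: for \<open>s = |t - x| / \<sigma>\<close> one has
  \<open>s^j \<le> 1 + s^4\<close>, so the fourth moment controls all lower absolute moments.
\<close>
lemma kantorovich_abs_moment_le:
  assumes x: "x \<in> {0..1}" and j: "j \<le> 4"
  shows "kantorovich n (\<lambda>t. \<bar>t - x\<bar> ^ j) x \<le> 2 * std_scale n ^ j"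
proof -
  have pw: "\<bar>t - x\<bar> ^ j \<le> std_scale n ^ j + std_scale n ^ j / std_scale n ^ 4 * (t - x)^4" for t
  proof -
    define s where "s = \<bar>t - x\<bar> / std_scale n"
    have s: "0 \<le> s" using std_scale_pos[of n] by (simp add: s_def)
    have "s ^ j \<le> 1 + s ^ 4"
    proof (cases "s \<le> 1")
      case True
      then show ?thesis using power_le_one[OF s True, of j] s by (simp add: add_increasing2)
    next
      case False
      then show ?thesis using power_increasing[OF j, of s] by linarith
    qed
    then have "std_scale n ^ j * s ^ j \<le> std_scale n ^ j * (1 + s ^ 4)"
      using std_scale_pos[of n] by simp
    moreover have "std_scale n ^ j * s ^ j = \<bar>t - x\<bar> ^ j"
      using std_scale_pos[of n] by (simp add: s_def power_divide)
    ultimately show ?thesis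
      by (simp add: s_def power_divide distrib_left)
  qed
  have "kantorovich n (\<lambda>t. \<bar>t - x\<bar> ^ j) x \<le> \<bar>kantorovich n (\<lambda>t. \<bar>t - x\<bar> ^ j) x\<bar>"
    by simp
  also have "\<dots> \<le> kantorovich n (\<lambda>t. std_scale n ^ j + std_scale n ^ j / std_scale n ^ 4 * (t - x)^4) x"
    using pw by (intro kantorovich_abs_le x) (auto intro!: continuous_intros simp: power_abs std_scale_pos[THEN less_imp_neq, symmetric])
  also have "\<dots> = std_scale n ^ j + std_scale n ^ j / std_scale n ^ 4 * kantorovich n (\<lambda>t. (t - x)^4) x"
    by (subst kantorovich_add) (auto intro!: continuous_intros simp: kantorovich_const kantorovich_cmult simp del: times_divide_eq_left)
  also have "\<dots> \<le> std_scale n ^ j + std_scale n ^ j / std_scale n ^ 4 * std_scale n ^ 4"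
    using std_scale_pos[of n] by (intro add_left_mono mult_left_mono kantorovich_fourth_moment_le x) simp
  also have "\<dots> = 2 * std_scale n ^ j"
    using std_scale_pos[of n] by simp
  finally show ?thesis .
qed

lemma kantorovich_abs_le_power:
  assumes x: "x \<in> {0..1}" and j: "j \<le> 4" and a: "continuous_on {0..1} a"
    and le: "\<And>t. t \<in> {0..1} \<Longrightarrow> \<bar>a t\<bar> \<le> \<alpha> * \<bar>t - x\<bar> ^ j" and \<alpha>: "0 \<le> \<alpha>"
  shows "\<bar>kantorovich n a x\<bar> \<le> 2 * \<alpha> * std_scale n ^ j"
proof -
  have "\<bar>kantorovich n a x\<bar> \<le> kantorovich n (\<lambda>t. \<alpha> * \<bar>t - x\<bar> ^ j) x"
    by (intro kantorovich_abs_le x a le) (auto intro!: continuous_intros)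
  also have "\<dots> = \<alpha> * kantorovich n (\<lambda>t. \<bar>t - x\<bar> ^ j) x"
    by (rule kantorovich_cmult)
  also have "\<dots> \<le> \<alpha> * (2 * std_scale n ^ j)"
    by (intro mult_left_mono kantorovich_abs_moment_le x j \<alpha>)
  finally show ?thesis by (simp add: mult_ac)
qed

text \<open>
  Both terms in the definition of the covariance have the order \<open>\<sigma>^(i+j)\<close>; the constant is
  \<open>6 = 2 + 2 * 2\<close>.
\<close>
lemma kantorovich_cov_le:
  assumes x: "x \<in> {0..1}" and ij: "i + j \<le> 4"
    and cont: "continuous_on {0..1} a" "continuous_on {0..1} b"
    and a: "\<And>t. t \<in> {0..1} \<Longrightarrow> \<bar>a t\<bar> \<le> \<alpha> * \<bar>t - x\<bar> ^ i" "0 \<le> \<alpha>"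
    and b: "\<And>t. t \<in> {0..1} \<Longrightarrow> \<bar>b t\<bar> \<le> \<beta> * \<bar>t - x\<bar> ^ j" "0 \<le> \<beta>"
  shows "\<bar>kantorovich_cov n x a b\<bar> \<le> 6 * \<alpha> * \<beta> * std_scale n ^ (i + j)"
proof -
  have "\<bar>kantorovich n (\<lambda>t. a t * b t) x\<bar> \<le> 2 * (\<alpha> * \<beta>) * std_scale n ^ (i + j)"
  proof (intro kantorovich_abs_le_power x ij continuous_intros cont)
    fix t :: real assume "t \<in> {0..1}"
    then have "\<bar>a t\<bar> * \<bar>b t\<bar> \<le> (\<alpha> * \<bar>t - x\<bar> ^ i) * (\<beta> * \<bar>t - x\<bar> ^ j)"
      using a b by (intro mult_mono) simp_all
    then show "\<bar>a t * b t\<bar> \<le> \<alpha> * \<beta> * \<bar>t - x\<bar> ^ (i + j)"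
      by (simp add: abs_mult power_add mult_ac)
  qed (use a b in simp)
  moreover have "\<bar>kantorovich n a x * kantorovich n b x\<bar> \<le> (2 * \<alpha> * std_scale n ^ i) * (2 * \<beta> * std_scale n ^ j)"
    unfolding abs_mult using ij std_scale_pos[of n] a(2)
    by (intro mult_mono kantorovich_abs_le_power x cont a b) simp_all
  moreover have "(2 * \<alpha> * std_scale n ^ i) * (2 * \<beta> * std_scale n ^ j) = 4 * (\<alpha> * \<beta> * std_scale n ^ (i + j))"
    by (simp add: power_add)
  ultimately show ?thesis
    unfolding kantorovich_cov_def by linarith
qed

text \<open>
  Only here does the limit \<open>x(1 - x)\<close> arise: the variance is exactly
  \<open>(n x(1 - x) + 1/12) / (n + 1)\<^sup>2\<close>, where \<open>1/12\<close> is the variance of the uniform distribution on a unit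
  interval.
\<close>
lemma kantorovich_variance:
  assumes "x \<in> {0..1}"
  shows "\<bar>real n * kantorovich_cov n x (\<lambda>t. t - x) (\<lambda>t. t - x) - x * (1 - x)\<bar> \<le> (std_scale n)\<^sup>2"
proof -
  define X where "X = x * (1 - x)"
  define N where "N = real n + 1"
  have X: "0 \<le> X" "X \<le> 1/4"
    using unit_interval_variance_bounds[OF assms] by (simp_all add: X_def)
  have N: "0 < N" by (simp add: N_def)
  have "kantorovich_cov n x (\<lambda>t. t - x) (\<lambda>t. t - x) * N\<^sup>2
      = kantorovich n (\<lambda>t. (t - x)\<^sup>2) x * N\<^sup>2 - (kantorovich n (\<lambda>t. t - x) x * N)\<^sup>2"
    by (simp add: kantorovich_cov_def left_diff_distrib power_mult_distrib flip: power2_eq_square)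
  also have "\<dots> = real n * X + 1/12"
    unfolding N_def kantorovich_moments by (simp add: X_def power2_eq_square field_simps)
  finally have var: "kantorovich_cov n x (\<lambda>t. t - x) (\<lambda>t. t - x) * N\<^sup>2 = real n * X + 1/12" .
  have "(real n * kantorovich_cov n x (\<lambda>t. t - x) (\<lambda>t. t - x) - X) * N\<^sup>2
      = real n * (kantorovich_cov n x (\<lambda>t. t - x) (\<lambda>t. t - x) * N\<^sup>2) - X * N\<^sup>2"
    by (simp add: algebra_simps)
  also have "\<dots> = real n / 12 - X * (2 * real n + 1)"
    unfolding var by (simp add: N_def power2_eq_square algebra_simps)
  finally have scaled: "(real n * kantorovich_cov n x (\<lambda>t. t - x) (\<lambda>t. t - x) - X) * N\<^sup>2
      = real n / 12 - X * (2 * real n + 1)" .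
  have "0 \<le> X * (2 * real n + 1)" "4 * (X * (2 * real n + 1)) \<le> 2 * real n + 1" "0 \<le> real n"
    using X mult_right_mono[of "4 * X" 1 "2 * real n + 1"] by (simp_all add: mult.assoc)
  moreover have "\<bar>m / 12 - P\<bar> \<le> m + 1" if "0 \<le> P" "4 * P \<le> 2 * m + 1" "0 \<le> m" for m P :: real
    using that by linarith
  ultimately have "\<bar>(real n * kantorovich_cov n x (\<lambda>t. t - x) (\<lambda>t. t - x) - X) * N\<^sup>2\<bar> \<le> N"
    unfolding scaled unfolding N_def by blast
  then have "\<bar>real n * kantorovich_cov n x (\<lambda>t. t - x) (\<lambda>t. t - x) - X\<bar> * N\<^sup>2 \<le> N"
    by (simp add: abs_mult)
  then show ?thesis
    unfolding std_scale_square X_def[symmetric] N_def[symmetric]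
    using N by (simp add: field_simps power2_eq_square)
qed

text \<open>
  The bound \<open>kantorovich_cov_le\<close> would only give the order \<open>\<sigma>^3\<close> here. The gain of one order comes from
  the signed third moment, which is of order \<open>n / (n + 1)^3\<close>.
\<close>
lemma kantorovich_cov_linear_square:
  assumes "x \<in> {0..1}"
  shows "\<bar>kantorovich_cov n x (\<lambda>t. t - x) (\<lambda>t. (t - x)\<^sup>2)\<bar> \<le> 2 * std_scale n ^ 4"
proof -
  define X where "X = x * (1 - x)"
  define N where "N = real n + 1"
  have X: "0 \<le> X" "X \<le> 1/4"
    using unit_interval_variance_bounds[OF assms] by (simp_all add: X_def)
  have N: "1 \<le> N" by (simp add: N_def)
  have nX: "0 \<le> real n * X" "real n * X \<le> real n * (1/4)"
    using X by (auto intro!: mult_left_mono simp del: times_divide_eq_right)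
  have "\<bar>kantorovich n (\<lambda>t. (t - x)^3) x * N^3\<bar> \<le> N * 1"
    unfolding N_def kantorovich_moments abs_mult X_def[symmetric]
    using nX X assms by (intro mult_mono) auto
  moreover have "\<bar>(kantorovich n (\<lambda>t. t - x) x * N) * (kantorovich n (\<lambda>t. (t - x)^2) x * N^2)\<bar> \<le> 1 * N"
    unfolding N_def kantorovich_moments abs_mult[of "1/2 - x"] X_def[symmetric]
  proof (intro mult_mono)
    show "\<bar>1/2 - x\<bar> \<le> 1" using assms by auto
    show "\<bar>real n * X + 1/3 - X\<bar> \<le> real n + 1" using nX X by linarith
  qed simp_all
  moreover have "kantorovich_cov n x (\<lambda>t. t - x) (\<lambda>t. (t - x)\<^sup>2) * N^3 =
      kantorovich n (\<lambda>t. (t - x)^3) x * N^3 - (kantorovich n (\<lambda>t. t - x) x * N) * (kantorovich n (\<lambda>t. (t - x)^2) x * N^2)"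
    by (simp add: kantorovich_cov_def eval_nat_numeral algebra_simps)
  ultimately have "\<bar>kantorovich_cov n x (\<lambda>t. t - x) (\<lambda>t. (t - x)\<^sup>2) * N^3\<bar> \<le> 2 * N"
    by linarith
  then have "\<bar>kantorovich_cov n x (\<lambda>t. t - x) (\<lambda>t. (t - x)\<^sup>2)\<bar> * N^3 \<le> 2 * N"
    using N by (simp add: abs_mult)
  then have "\<bar>kantorovich_cov n x (\<lambda>t. t - x) (\<lambda>t. (t - x)\<^sup>2)\<bar> \<le> 2 * N / N^3"
    using N by (simp add: pos_le_divide_eq)
  also have "\<dots> = 2 * std_scale n ^ 4"
    unfolding std_scale_power4 N_def[symmetric] by (simp add: power2_eq_square power3_eq_cube)
  finally show ?thesis .
qed

section \<open>Taylor remainders on the unit interval\<close>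
lemma has_real_derivative_deriv01:
  assumes "h differentiable_on {0..1}" "t \<in> {0..1}"
  shows "(h has_real_derivative deriv01 h t) (at t within {0..1})"
  using assms
  by (simp add: deriv01_def differentiable_on_def has_real_derivative_iff_has_vector_derivative
      flip: vector_derivative_works)

lemma C01_2D:
  assumes "f \<in> C01 2"
  shows "f differentiable_on {0..1}" "deriv01 f differentiable_on {0..1}"
    "continuous_on {0..1} (deriv01 (deriv01 f))"
  using assms by (auto simp: C01_def numeral_2_eq_2 less_Suc_eq)

lemma C01_3D:
  assumes "f \<in> C01 3"
  shows "deriv01 (deriv01 f) differentiable_on {0..1}"
    "continuous_on {0..1} (deriv01 (deriv01 (deriv01 f)))"
  using assms by (auto simp: C01_def numeral_3_eq_3 less_Suc_eq)

lemma C01_Suc_subset: "C01 (Suc m) \<subseteq> C01 m"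
  by (auto simp: C01_def intro: differentiable_imp_continuous_on)

lemma C01_continuous_on:
  assumes "f \<in> C01 2"
  shows "continuous_on {0..1} f"
  using C01_2D(1)[OF assms] by (rule differentiable_imp_continuous_on)

lemma continuous_on_unit_interval_bounded:
  fixes h :: "real \<Rightarrow> real"
  assumes "continuous_on {0..1} h"
  obtains M where "0 \<le> M" "\<And>t. t \<in> {0..1} \<Longrightarrow> \<bar>h t\<bar> \<le> M"
proof -
  have "bounded (h ` {0..1})"
    using assms by (intro compact_imp_bounded compact_continuous_image) simp_all
  then obtain M where "\<And>y. y \<in> h ` {0..1} \<Longrightarrow> \<bar>y\<bar> \<le> M"
    by (auto simp: bounded_iff)
  then show thesis
    by (intro that[of "max 0 M"]) (force simp: le_max_iff_disj)+
qed

text \<open>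
  The mean value inequality on the segment from \<open>x\<close> to \<open>t\<close>. Applied repeatedly, it gives Taylor
  estimates from one-sided derivatives, without the factorials of the sharp form.
\<close>
lemma abs_le_power_Suc_of_deriv:
  fixes h h' :: "real \<Rightarrow> real"
  assumes deriv: "\<And>s. s \<in> {0..1} \<Longrightarrow> (h has_real_derivative h' s) (at s within {0..1})"
    and le: "\<And>s. s \<in> {0..1} \<Longrightarrow> \<bar>h' s\<bar> \<le> M * \<bar>s - x\<bar> ^ k" and M: "0 \<le> M"
    and "h x = 0" and x: "x \<in> {0..1}" and t: "t \<in> {0..1}"
  shows "\<bar>h t\<bar> \<le> M * \<bar>t - x\<bar> ^ Suc k"
proof -
  have sub: "closed_segment x t \<subseteq> {0..1}"
    using x t by (simp add: closed_segment_subset)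
  have "norm (h t - h x) \<le> M * \<bar>t - x\<bar> ^ k * norm (t - x)"
  proof (rule field_differentiable_bound)
    fix s assume s: "s \<in> closed_segment x t"
    show "(h has_field_derivative h' s) (at s within closed_segment x t)"
      using deriv s sub DERIV_subset by blast
    have "\<bar>s - x\<bar> \<le> \<bar>t - x\<bar>"
      using s by (auto simp: closed_segment_eq_real_ivl split: if_splits)
    then have "M * \<bar>s - x\<bar> ^ k \<le> M * \<bar>t - x\<bar> ^ k"
      using M by (intro mult_left_mono power_mono) simp_all
    then show "norm (h' s) \<le> M * \<bar>t - x\<bar> ^ k"
      using le[of s] s sub by auto
  qed simp_all
  then show ?thesis
    using \<open>h x = 0\<close> by (simp add: mult_ac)
qed

definition linear_remainder :: "(real \<Rightarrow> real) \<Rightarrow> real \<Rightarrow> real \<Rightarrow> real" where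
  "linear_remainder f x t = f t - f x - deriv01 f x * (t - x)"

lemma continuous_on_linear_remainder:
  "f \<in> C01 2 \<Longrightarrow> continuous_on {0..1} (linear_remainder f x)"
  unfolding linear_remainder_def by (intro continuous_intros C01_continuous_on)

lemma linear_remainder_quadratic:
  assumes f: "f \<in> C01 2"
  obtains M where "0 \<le> M" "\<And>x. x \<in> {0..1} \<Longrightarrow> \<bar>deriv01 f x\<bar> \<le> M"
    "\<And>x t. x \<in> {0..1} \<Longrightarrow> t \<in> {0..1} \<Longrightarrow> \<bar>linear_remainder f x t\<bar> \<le> M * \<bar>t - x\<bar> ^ 2"
proof -
  note d = C01_2D[OF f]
  obtain M1 where M1: "0 \<le> M1" "\<And>t. t \<in> {0..1} \<Longrightarrow> \<bar>deriv01 f t\<bar> \<le> M1"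
    by (rule continuous_on_unit_interval_bounded[OF differentiable_imp_continuous_on[OF d(2)]], blast)
  obtain M2 where M2: "0 \<le> M2" "\<And>t. t \<in> {0..1} \<Longrightarrow> \<bar>deriv01 (deriv01 f) t\<bar> \<le> M2"
    by (rule continuous_on_unit_interval_bounded[OF d(3)], blast)
  have quad: "\<bar>linear_remainder f x t\<bar> \<le> M2 * \<bar>t - x\<bar> ^ Suc 1" if x: "x \<in> {0..1}" and t: "t \<in> {0..1}" for x t
  proof (rule abs_le_power_Suc_of_deriv[where h' = "\<lambda>s. deriv01 f s - deriv01 f x", OF _ _ M2(1) _ x t])
    fix s :: real assume s: "s \<in> {0..1}"
    show "(linear_remainder f x has_real_derivative deriv01 f s - deriv01 f x) (at s within {0..1})"
      unfolding linear_remainder_def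
      by (auto intro!: derivative_eq_intros has_real_derivative_deriv01 d s)
    have "\<bar>deriv01 f s - deriv01 f x\<bar> \<le> M2 * \<bar>s - x\<bar> ^ Suc 0"
      by (rule abs_le_power_Suc_of_deriv[where h' = "deriv01 (deriv01 f)", OF _ _ M2(1) _ x s])
         (auto intro!: derivative_eq_intros has_real_derivative_deriv01 d M2)
    then show "\<bar>deriv01 f s - deriv01 f x\<bar> \<le> M2 * \<bar>s - x\<bar> ^ 1" by simp
  qed (simp add: linear_remainder_def)
  show thesis
  proof (rule that[of "max M1 M2"])
    fix x t :: real assume "x \<in> {0..1}" "t \<in> {0..1}"
    then have "\<bar>linear_remainder f x t\<bar> \<le> M2 * \<bar>t - x\<bar> ^ 2"
      using quad by (simp add: numeral_2_eq_2)
    also have "\<dots> \<le> max M1 M2 * \<bar>t - x\<bar> ^ 2"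
      by (intro mult_right_mono) simp_all
    finally show "\<bar>linear_remainder f x t\<bar> \<le> max M1 M2 * \<bar>t - x\<bar> ^ 2" .
  qed (use M1 M2 in \<open>auto simp: le_max_iff_disj\<close>)
qed

lemma linear_remainder_cubic:
  assumes f: "f \<in> C01 2" "f \<in> C01 3"
  obtains M where "0 \<le> M" "\<And>x. x \<in> {0..1} \<Longrightarrow> \<bar>deriv01 (deriv01 f) x\<bar> \<le> M"
    "\<And>x t. x \<in> {0..1} \<Longrightarrow> t \<in> {0..1} \<Longrightarrow>
       \<bar>linear_remainder f x t - deriv01 (deriv01 f) x / 2 * (t - x)\<^sup>2\<bar> \<le> M * \<bar>t - x\<bar> ^ 3"
proof -
  note d = C01_2D[OF f(1)] C01_3D[OF f(2)]
  obtain M2 where M2: "0 \<le> M2" "\<And>t. t \<in> {0..1} \<Longrightarrow> \<bar>deriv01 (deriv01 f) t\<bar> \<le> M2"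
    by (rule continuous_on_unit_interval_bounded[OF d(3)], blast)
  obtain M3 where M3: "0 \<le> M3" "\<And>t. t \<in> {0..1} \<Longrightarrow> \<bar>deriv01 (deriv01 (deriv01 f)) t\<bar> \<le> M3"
    by (rule continuous_on_unit_interval_bounded[OF d(5)], blast)
  have cubic: "\<bar>linear_remainder f x t - deriv01 (deriv01 f) x / 2 * (t - x)\<^sup>2\<bar> \<le> M3 * \<bar>t - x\<bar> ^ Suc 2"
    if x: "x \<in> {0..1}" and t: "t \<in> {0..1}" for x t
  proof (rule abs_le_power_Suc_of_deriv[where h' = "\<lambda>s. deriv01 f s - deriv01 f x - deriv01 (deriv01 f) x * (s - x)",
        OF _ _ M3(1) _ x t])
    fix s :: real assume s: "s \<in> {0..1}"
    show "((\<lambda>t. linear_remainder f x t - deriv01 (deriv01 f) x / 2 * (t - x)\<^sup>2) has_real_derivative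
        deriv01 f s - deriv01 f x - deriv01 (deriv01 f) x * (s - x)) (at s within {0..1})"
      unfolding linear_remainder_def
      by (auto intro!: derivative_eq_intros has_real_derivative_deriv01 d s)
    have "\<bar>deriv01 f s - deriv01 f x - deriv01 (deriv01 f) x * (s - x)\<bar> \<le> M3 * \<bar>s - x\<bar> ^ Suc 1"
    proof (rule abs_le_power_Suc_of_deriv[where h' = "\<lambda>s. deriv01 (deriv01 f) s - deriv01 (deriv01 f) x",
          OF _ _ M3(1) _ x s])
      fix r :: real assume r: "r \<in> {0..1}"
      show "((\<lambda>s. deriv01 f s - deriv01 f x - deriv01 (deriv01 f) x * (s - x)) has_real_derivative
          deriv01 (deriv01 f) r - deriv01 (deriv01 f) x) (at r within {0..1})"
        by (auto intro!: derivative_eq_intros has_real_derivative_deriv01 d r)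
      have "\<bar>deriv01 (deriv01 f) r - deriv01 (deriv01 f) x\<bar> \<le> M3 * \<bar>r - x\<bar> ^ Suc 0"
        by (rule abs_le_power_Suc_of_deriv[where h' = "deriv01 (deriv01 (deriv01 f))", OF _ _ M3(1) _ x r])
           (auto intro!: derivative_eq_intros has_real_derivative_deriv01 d M3)
      then show "\<bar>deriv01 (deriv01 f) r - deriv01 (deriv01 f) x\<bar> \<le> M3 * \<bar>r - x\<bar> ^ 1" by simp
    qed simp
    then show "\<bar>deriv01 f s - deriv01 f x - deriv01 (deriv01 f) x * (s - x)\<bar> \<le> M3 * \<bar>s - x\<bar> ^ 2"
      by (simp add: numeral_2_eq_2)
  qed (simp add: linear_remainder_def)
  show thesis
  proof (rule that[of "max M2 M3"])
    fix x t :: real assume "x \<in> {0..1}" "t \<in> {0..1}"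
    then have "\<bar>linear_remainder f x t - deriv01 (deriv01 f) x / 2 * (t - x)\<^sup>2\<bar> \<le> M3 * \<bar>t - x\<bar> ^ 3"
      using cubic by (simp add: numeral_3_eq_3)
    also have "\<dots> \<le> max M2 M3 * \<bar>t - x\<bar> ^ 3"
      by (intro mult_right_mono) simp_all
    finally show "\<bar>linear_remainder f x t - deriv01 (deriv01 f) x / 2 * (t - x)\<^sup>2\<bar> \<le> max M2 M3 * \<bar>t - x\<bar> ^ 3" .
  qed (use M2 M3 in \<open>auto simp: le_max_iff_disj\<close>)
qed

section \<open>Asymptotics of the covariance\<close>

text \<open>
  All that the final estimate uses about a function. The parameter \<open>q\<close> is the resulting rate
  \<open>\<sigma>^q\<close> of the error: smoothness only enters through the order \<open>q + 2\<close> of the covariance between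
  \<open>t - x\<close> and the linear remainder, the factor \<open>n\<close> costing two orders.
\<close>
definition remainder_bound :: "nat \<Rightarrow> (real \<Rightarrow> real) \<Rightarrow> real \<Rightarrow> bool" where
  "remainder_bound q f M \<longleftrightarrow> 0 \<le> M \<and> (\<forall>x\<in>{0..1}. \<bar>deriv01 f x\<bar> \<le> M \<and>
     (\<forall>t\<in>{0..1}. \<bar>linear_remainder f x t\<bar> \<le> M * \<bar>t - x\<bar> ^ 2) \<and>
     (\<forall>n. \<bar>kantorovich_cov n x (\<lambda>t. t - x) (linear_remainder f x)\<bar> \<le> M * std_scale n ^ (q + 2)))"

lemma remainder_bound_C2:
  assumes f: "f \<in> C01 2"
  obtains M where "remainder_bound 1 f M"
proof -
  obtain M where M: "0 \<le> M" "\<And>x. x \<in> {0..1} \<Longrightarrow> \<bar>deriv01 f x\<bar> \<le> M"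
    "\<And>x t. x \<in> {0..1} \<Longrightarrow> t \<in> {0..1} \<Longrightarrow> \<bar>linear_remainder f x t\<bar> \<le> M * \<bar>t - x\<bar> ^ 2"
    by (rule linear_remainder_quadratic[OF f], blast)
  have "\<bar>kantorovich_cov n x (\<lambda>t. t - x) (linear_remainder f x)\<bar> \<le> 6 * 1 * M * std_scale n ^ (1 + 2)"
    if "x \<in> {0..1}" for x n
    using M that
    by (intro kantorovich_cov_le continuous_on_linear_remainder f) (auto intro!: continuous_intros)
  note cov = this
  have "remainder_bound 1 f (6 * M)"
    unfolding remainder_bound_def
  proof (intro conjI ballI allI)
    fix x :: real assume x: "x \<in> {0..1}"
    show "\<bar>deriv01 f x\<bar> \<le> 6 * M" using M(1) M(2)[OF x] by linarith
    show "\<bar>linear_remainder f x t\<bar> \<le> 6 * M * \<bar>t - x\<bar> ^ 2" if "t \<in> {0..1}" for t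
      using M(3)[OF x that] mult_right_mono[of M "6 * M" "\<bar>t - x\<bar> ^ 2"] M(1) by simp
    show "\<bar>kantorovich_cov n x (\<lambda>t. t - x) (linear_remainder f x)\<bar> \<le> 6 * M * std_scale n ^ (1 + 2)" for n
      using cov[OF x, of n] by simp
  qed (use M in simp)
  then show thesis by (rule that)
qed

text \<open>
  The quadratic part of the remainder is handled by the small covariance of \<open>t - x\<close> with its square,
  and the cubic part by its size.
\<close>
lemma remainder_bound_C3:
  assumes f: "f \<in> C01 2" "f \<in> C01 3"
  obtains M where "remainder_bound 2 f M"
proof -
  obtain M where M: "0 \<le> M" "\<And>x. x \<in> {0..1} \<Longrightarrow> \<bar>deriv01 f x\<bar> \<le> M"
    "\<And>x t. x \<in> {0..1} \<Longrightarrow> t \<in> {0..1} \<Longrightarrow> \<bar>linear_remainder f x t\<bar> \<le> M * \<bar>t - x\<bar> ^ 2"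
    by (rule linear_remainder_quadratic[OF f(1)], blast)
  obtain L where L: "0 \<le> L" "\<And>x. x \<in> {0..1} \<Longrightarrow> \<bar>deriv01 (deriv01 f) x\<bar> \<le> L"
    "\<And>x t. x \<in> {0..1} \<Longrightarrow> t \<in> {0..1} \<Longrightarrow>
       \<bar>linear_remainder f x t - deriv01 (deriv01 f) x / 2 * (t - x)\<^sup>2\<bar> \<le> L * \<bar>t - x\<bar> ^ 3"
    by (rule linear_remainder_cubic[OF f], blast)
  have cov: "\<bar>kantorovich_cov n x (\<lambda>t. t - x) (linear_remainder f x)\<bar> \<le> 7 * L * std_scale n ^ 4"
    if x: "x \<in> {0..1}" for x n
  proof -
    define c where "c = deriv01 (deriv01 f) x / 2"
    define r where "r = (\<lambda>t. linear_remainder f x t - c * (t - x)\<^sup>2)"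
    have r: "continuous_on {0..1} r"
      unfolding r_def by (intro continuous_intros continuous_on_linear_remainder f)
    have "kantorovich_cov n x (\<lambda>t. t - x) (linear_remainder f x)
        = kantorovich_cov n x (\<lambda>t. 0 + c * (t - x)\<^sup>2 + r t) (\<lambda>t. t - x)"
      by (subst kantorovich_cov_commute) (simp add: r_def)
    also have "\<dots> = c * kantorovich_cov n x (\<lambda>t. (t - x)\<^sup>2) (\<lambda>t. t - x) + kantorovich_cov n x r (\<lambda>t. t - x)"
      by (intro kantorovich_cov_affine_left r continuous_intros)
    finally have split: "kantorovich_cov n x (\<lambda>t. t - x) (linear_remainder f x)
        = c * kantorovich_cov n x (\<lambda>t. t - x) (\<lambda>t. (t - x)\<^sup>2) + kantorovich_cov n x r (\<lambda>t. t - x)"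
      by (simp only: kantorovich_cov_commute)
    have "\<bar>c * kantorovich_cov n x (\<lambda>t. t - x) (\<lambda>t. (t - x)\<^sup>2)\<bar> \<le> (L / 2) * (2 * std_scale n ^ 4)"
      unfolding abs_mult using L(1) L(2)[OF x]
      by (intro mult_mono kantorovich_cov_linear_square x) (simp_all add: c_def)
    moreover have "\<bar>kantorovich_cov n x r (\<lambda>t. t - x)\<bar> \<le> 6 * L * 1 * std_scale n ^ (3 + 1)"
      using L x by (intro kantorovich_cov_le r) (auto intro!: continuous_intros simp: r_def c_def)
    ultimately show ?thesis
      unfolding split by simp
  qed
  have "remainder_bound 2 f (M + 7 * L)"
    unfolding remainder_bound_def
  proof (intro conjI ballI allI)
    fix x :: real assume x: "x \<in> {0..1}"
    show "\<bar>deriv01 f x\<bar> \<le> M + 7 * L" using M(2)[OF x] L(1) by linarith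
    show "\<bar>linear_remainder f x t\<bar> \<le> (M + 7 * L) * \<bar>t - x\<bar> ^ 2" if "t \<in> {0..1}" for t
      using M(3)[OF x that] L(1) by (simp add: distrib_right add_increasing2)
    show "\<bar>kantorovich_cov n x (\<lambda>t. t - x) (linear_remainder f x)\<bar> \<le> (M + 7 * L) * std_scale n ^ (2 + 2)" for n
      using cov[OF x, of n] M(1) std_scale_pos[of n] by (simp add: distrib_right add_increasing)
  qed (use M L in simp)
  then show thesis by (rule that)
qed

lemma kantorovich_cov_expansion:
  assumes f: "f \<in> C01 2" and g: "g \<in> C01 2"
  defines "u \<equiv> \<lambda>x t. t - x :: real"
  shows "kantorovich_cov n x f g =
      deriv01 f x * deriv01 g x * kantorovich_cov n x (u x) (u x)
    + deriv01 f x * kantorovich_cov n x (u x) (linear_remainder g x)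
    + deriv01 g x * kantorovich_cov n x (u x) (linear_remainder f x)
    + kantorovich_cov n x (linear_remainder f x) (linear_remainder g x)"
proof -
  have split_left: "kantorovich_cov n x h b =
      deriv01 h x * kantorovich_cov n x (u x) b + kantorovich_cov n x (linear_remainder h x) b"
    if h: "h \<in> C01 2" and b: "continuous_on {0..1} b" for h b
  proof -
    have "kantorovich_cov n x h b =
        kantorovich_cov n x (\<lambda>t. h x + deriv01 h x * u x t + linear_remainder h x t) b"
      by (simp add: linear_remainder_def u_def)
    also have "\<dots> = deriv01 h x * kantorovich_cov n x (u x) b + kantorovich_cov n x (linear_remainder h x) b"
      unfolding u_def by (intro kantorovich_cov_affine_left continuous_on_linear_remainder h b continuous_intros)
    finally show ?thesis .
  qed
  have u: "continuous_on {0..1} (u x)"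
    unfolding u_def by (intro continuous_intros)
  have "kantorovich_cov n x (u x) g =
      deriv01 g x * kantorovich_cov n x (u x) (u x) + kantorovich_cov n x (u x) (linear_remainder g x)"
    using split_left[OF g u]
    by (simp only: kantorovich_cov_commute[of n x g] kantorovich_cov_commute[of n x "linear_remainder g x"])
  moreover have "kantorovich_cov n x (linear_remainder f x) g =
      deriv01 g x * kantorovich_cov n x (u x) (linear_remainder f x)
      + kantorovich_cov n x (linear_remainder f x) (linear_remainder g x)"
    using split_left[OF g continuous_on_linear_remainder[OF f, of x]]
    by (simp only: kantorovich_cov_commute[of n x g]
        kantorovich_cov_commute[of n x "linear_remainder g x" "linear_remainder f x"])
  ultimately show ?thesis
    unfolding split_left[OF f C01_continuous_on[OF g]] by (simp only: distrib_left mult.assoc add.assoc)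
qed

text \<open>
  Of the four terms of the expansion, the first one carries the limit with an error of order \<open>\<sigma>\<^sup>2\<close>,
  and the others have order at most \<open>n \<sigma>^(q+2) \<le> \<sigma>^q\<close>. The restriction \<open>q \<le> 2\<close> reflects the first and the
  last term, which are not smaller than \<open>\<sigma>\<^sup>2\<close> in general.
\<close>
lemma kantorovich_cov_asymptotics:
  assumes f: "f \<in> C01 2" "remainder_bound q f M" and g: "g \<in> C01 2" "remainder_bound q g L"
    and q: "q \<le> 2" and x: "x \<in> {0..1}"
  shows "\<bar>real n * kantorovich_cov n x f g - x * (1 - x) * deriv01 f x * deriv01 g x\<bar>
    \<le> 9 * (M * L) * std_scale n ^ q"
proof -
  define \<sigma> where "\<sigma> = std_scale n"
  have \<sigma>: "0 < \<sigma>" "\<sigma> \<le> 1" "real n * \<sigma>\<^sup>2 \<le> 1"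
    by (simp_all add: \<sigma>_def std_scale_pos std_scale_le_1 std_scale_square)
  have M: "0 \<le> M" "\<bar>deriv01 f x\<bar> \<le> M"
      "\<And>t. t \<in> {0..1} \<Longrightarrow> \<bar>linear_remainder f x t\<bar> \<le> M * \<bar>t - x\<bar> ^ 2"
      "\<bar>kantorovich_cov n x (\<lambda>t. t - x) (linear_remainder f x)\<bar> \<le> M * \<sigma> ^ (q + 2)"
    using f(2) x by (auto simp: remainder_bound_def \<sigma>_def)
  have L: "0 \<le> L" "\<bar>deriv01 g x\<bar> \<le> L"
      "\<And>t. t \<in> {0..1} \<Longrightarrow> \<bar>linear_remainder g x t\<bar> \<le> L * \<bar>t - x\<bar> ^ 2"
      "\<bar>kantorovich_cov n x (\<lambda>t. t - x) (linear_remainder g x)\<bar> \<le> L * \<sigma> ^ (q + 2)"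
    using g(2) x by (auto simp: remainder_bound_def \<sigma>_def)
  define V A B C where "V = real n * kantorovich_cov n x (\<lambda>t. t - x) (\<lambda>t. t - x) - x * (1 - x)"
    and "A = deriv01 f x * kantorovich_cov n x (\<lambda>t. t - x) (linear_remainder g x)"
    and "B = deriv01 g x * kantorovich_cov n x (\<lambda>t. t - x) (linear_remainder f x)"
    and "C = kantorovich_cov n x (linear_remainder f x) (linear_remainder g x)"
  have prod_nonneg: "0 \<le> M * L" using M(1) L(1) by simp
  have "\<bar>deriv01 f x * deriv01 g x * V\<bar> \<le> M * L * \<sigma>\<^sup>2"
    unfolding abs_mult V_def \<sigma>_def using M L by (intro mult_mono kantorovich_variance x) simp_all
  also have "\<dots> \<le> M * L * \<sigma> ^ q"
    using prod_nonneg \<sigma> q by (intro mult_left_mono power_decreasing) simp_all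
  finally have V: "\<bar>deriv01 f x * deriv01 g x * V\<bar> \<le> M * L * \<sigma> ^ q" .
  have "\<bar>A\<bar> \<le> M * (L * \<sigma> ^ (q + 2))"
    unfolding abs_mult A_def by (intro mult_mono M(2) L(4) M(1)) simp
  then have A: "\<bar>A\<bar> \<le> M * L * \<sigma> ^ (q + 2)" by (simp only: mult.assoc)
  have "\<bar>B\<bar> \<le> L * (M * \<sigma> ^ (q + 2))"
    unfolding abs_mult B_def by (intro mult_mono L(2) M(4) L(1)) simp
  then have B: "\<bar>B\<bar> \<le> M * L * \<sigma> ^ (q + 2)" by (simp only: mult.assoc mult.left_commute)
  have "\<bar>C\<bar> \<le> 6 * M * L * \<sigma> ^ (2 + 2)"
    unfolding C_def \<sigma>_def
    by (intro kantorovich_cov_le x continuous_on_linear_remainder f g M(1,3) L(1,3)) simp_all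
  also have "\<dots> = 6 * (M * L * \<sigma> ^ (2 + 2))"
    by simp
  also have "\<dots> \<le> 6 * (M * L * \<sigma> ^ (q + 2))"
    using prod_nonneg \<sigma> q by (intro mult_left_mono power_decreasing) simp_all
  finally have "\<bar>C\<bar> \<le> 6 * (M * L * \<sigma> ^ (q + 2))" .
  with A B have ABC: "\<bar>A + B + C\<bar> \<le> 8 * (M * L * \<sigma> ^ (q + 2))"
    by linarith
  have "\<bar>real n * (A + B + C)\<bar> \<le> real n * (8 * (M * L * \<sigma> ^ (q + 2)))"
    unfolding abs_mult using ABC by (simp add: mult_left_mono)
  also have "\<dots> = 8 * (M * L * \<sigma> ^ q) * (real n * \<sigma>\<^sup>2)"
    by (simp add: power_add power2_eq_square)
  also have "\<dots> \<le> 8 * (M * L * \<sigma> ^ q) * 1"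
    using M L \<sigma> by (intro mult_left_mono) simp_all
  finally have rest: "\<bar>real n * (A + B + C)\<bar> \<le> 8 * (M * L * \<sigma> ^ q) * 1" .
  have "m * (d * e * v + a + b + c) - y * d * e = d * e * (m * v - y) + m * (a + b + c)"
    for m d e v a b c y :: real
    by (simp add: algebra_simps)
  then have "real n * kantorovich_cov n x f g - x * (1 - x) * deriv01 f x * deriv01 g x
      = deriv01 f x * deriv01 g x * V + real n * (A + B + C)"
    unfolding kantorovich_cov_expansion[OF f(1) g(1)] V_def A_def B_def C_def .
  then have "\<bar>real n * kantorovich_cov n x f g - x * (1 - x) * deriv01 f x * deriv01 g x\<bar>
      \<le> \<bar>deriv01 f x * deriv01 g x * V\<bar> + \<bar>real n * (A + B + C)\<bar>"
    by (simp only: abs_triangle_ineq)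
  also have "\<dots> \<le> M * L * \<sigma> ^ q + 8 * (M * L * \<sigma> ^ q) * 1"
    using V rest by (rule add_mono)
  also have "\<dots> = 9 * (M * L) * std_scale n ^ q"
    by (simp add: \<sigma>_def)
  finally show ?thesis .
qed

text \<open>
  The pointwise bound also supplies the boundedness without which the real supremum would have no
  meaning, and the supremum is then nonnegative.
\<close>
lemma supnorm01_le:
  assumes "\<And>x. x \<in> {0..1} \<Longrightarrow> \<bar>h x\<bar> \<le> c"
  shows "\<bar>supnorm01 h\<bar> \<le> c"
proof -
  have "bdd_above ((\<lambda>x. \<bar>h x\<bar>) ` {0..1})"
    using assms by (intro bdd_aboveI2[where M = c]) auto
  then have "\<bar>h 0\<bar> \<le> supnorm01 h"
    unfolding supnorm01_def by (intro cSUP_upper[of 0 "{0..1}" "\<lambda>x. \<bar>h x\<bar>"]) simp_all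
  moreover have "supnorm01 h \<le> c"
    unfolding supnorm01_def using assms by (intro cSUP_least) auto
  ultimately show ?thesis by simp
qed

lemma supnorm01_kantorovich_cov_bigo:
  assumes "f \<in> C01 2" "remainder_bound q f M" "g \<in> C01 2" "remainder_bound q g L" "q \<le> 2"
  shows "(\<lambda>n. supnorm01 (\<lambda>x. real n * kantorovich_cov n x f g
            - x * (1 - x) * deriv01 f x * deriv01 g x)) \<in> O(\<lambda>n. std_scale n ^ q)"
proof (rule bigoI[where c = "9 * (M * L)"], rule always_eventually, rule allI)
  fix n
  have "norm (std_scale n ^ q) = std_scale n ^ q"
    using std_scale_pos[of n] by simp
  then show "norm (supnorm01 (\<lambda>x. real n * kantorovich_cov n x f g - x * (1 - x) * deriv01 f x * deriv01 g x))
      \<le> 9 * (M * L) * norm (std_scale n ^ q)"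
    unfolding real_norm_def
    by (simp only:) (rule supnorm01_le, rule kantorovich_cov_asymptotics[OF assms])
qed

lemma std_scale_bigo: "std_scale \<in> O(\<lambda>n. 1 / sqrt (real n))"
proof (rule bigoI[where c = 1])
  show "\<forall>\<^sub>F n in sequentially. norm (std_scale n) \<le> 1 * norm (1 / sqrt (real n))"
    using eventually_gt_at_top[of 0]
  proof eventually_elim
    case (elim n)
    then have "1 / sqrt (real n + 1) \<le> 1 / sqrt (real n)"
      by (intro divide_left_mono) simp_all
    then show ?case by (simp add: std_scale_def)
  qed
qed

lemma std_scale_square_bigo: "(\<lambda>n. std_scale n ^ 2) \<in> O(\<lambda>n. 1 / real n)"
proof (rule bigoI[where c = 1])
  show "\<forall>\<^sub>F n in sequentially. norm ((std_scale n)\<^sup>2) \<le> 1 * norm (1 / real n)"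
    using eventually_gt_at_top[of 0]
  proof eventually_elim
    case (elim n)
    then have "1 / (real n + 1) \<le> 1 / real n"
      by (intro divide_left_mono) simp_all
    then show ?case by (simp add: std_scale_square)
  qed
qed

theorem theorem5p1:
  fixes f g :: "real \<Rightarrow> real"
  assumes "f \<in> C01 2" and "g \<in> C01 2"
  shows "let E = (\<lambda>n::nat. supnorm01 (\<lambda>x.
             real n * (kantorovich n (\<lambda>t. f t * g t) x - kantorovich n f x * kantorovich n g x)
               - x * (1 - x) * deriv01 f x * deriv01 g x))
         in E \<in> o(\<lambda>n. 1) \<and>
            (f \<in> C01 3 \<and> g \<in> C01 3 \<longrightarrow> E \<in> O(\<lambda>n. 1 / sqrt (real n))) \<and>
            (f \<in> C01 4 \<and> g \<in> C01 4 \<longrightarrow> E \<in> O(\<lambda>n. 1 / real n))"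
proof -
  define E where "E = (\<lambda>n::nat. supnorm01 (\<lambda>x.
             real n * (kantorovich n (\<lambda>t. f t * g t) x - kantorovich n f x * kantorovich n g x)
               - x * (1 - x) * deriv01 f x * deriv01 g x))"
  have E: "E = (\<lambda>n. supnorm01 (\<lambda>x. real n * kantorovich_cov n x f g
            - x * (1 - x) * deriv01 f x * deriv01 g x))"
    by (simp add: E_def kantorovich_cov_def)
  obtain M where M: "remainder_bound 1 f M" using remainder_bound_C2[OF assms(1)] .
  obtain L where L: "remainder_bound 1 g L" using remainder_bound_C2[OF assms(2)] .
  have "E \<in> O(\<lambda>n. std_scale n ^ 1)"
    unfolding E by (rule supnorm01_kantorovich_cov_bigo[OF assms(1) M assms(2) L]) simp
  then have sqrt_rate: "E \<in> O(\<lambda>n. 1 / sqrt (real n))"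
    using std_scale_bigo by (auto intro: landau_o.big_trans)
  moreover have "(\<lambda>n. 1 / sqrt (real n)) \<in> o(\<lambda>n. 1)"
    by (rule smalloI_tendsto) (auto intro!: real_tendsto_divide_at_top[OF tendsto_const] filterlim_compose[OF sqrt_at_top] filterlim_real_sequentially)
  ultimately have "E \<in> o(\<lambda>n. 1)"
    by (rule landau_o.big_small_trans)
  moreover have "E \<in> O(\<lambda>n. 1 / real n)" if "f \<in> C01 4" "g \<in> C01 4"
  proof -
    have "f \<in> C01 3" "g \<in> C01 3"
      using that C01_Suc_subset[of 3] by auto
    obtain M where M: "remainder_bound 2 f M"
      using remainder_bound_C3[OF assms(1) \<open>f \<in> C01 3\<close>] .
    obtain L where L: "remainder_bound 2 g L"
      using remainder_bound_C3[OF assms(2) \<open>g \<in> C01 3\<close>] .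
    have "E \<in> O(\<lambda>n. std_scale n ^ 2)"
      unfolding E by (rule supnorm01_kantorovich_cov_bigo[OF assms(1) M assms(2) L]) simp
    then show ?thesis
      using std_scale_square_bigo by (rule landau_o.big_trans)
  qed
  ultimately show ?thesis
    using sqrt_rate by (simp add: E_def Let_def)
qed

end
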